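(* Let $K\ge 1$ be an integer and let $S(L)$ be the expected number of slots used by the generalized tree-splitting protocol with parameter $K$ to resolve $L$ contending users. Let $\alpha^*=1+\frac1K$ and $\beta^*=1+\frac{2}{(K+1)(1-2^{-K})}$. Then $S(L)=L$ for every integer $L$ with $1\le L\le K$, and for every integer $L>K$ $$\alpha^* L-1\le S(L)\le \beta^* L-1 .$$
   Context: Generalized tree-splitting protocol with parameter $K\ge1$. Let $T(L)$ be the random number of slots used to resolve a group of $L\ge 0$ users. If $L=0$, exactly one (empty) slot is used. If $1\le L\le K$, exactly $L$ slots are used (one slot in which all $L$ users transmit and their identities are learned, followed by $L-1$ slots in which $L-1$ of the users are polled individually). If $L>K$, one slot is used (a collision), after which each of the $L$ users independently joins group 1 or group 2 with probability $1/2$ each; then group 1 is resolved by a fresh run of the same protocol (with independent randomness), and afterwards group 2 is resolved by a fresh run of the same protocol (this also applies to empty groups). $T(L)$ is the total number of slots, and $S(L)=\mathbb{E}[T(L)]$. *)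

theory Defs
  imports "HOL-Probability.Probability"
begin

text \<open>
  The distribution of the number of slots. The users of a group of size \<open>L\<close> are
  \<open>{..<L}\<close>, and user \<open>i\<close> joins group 1 iff \<open>g i\<close>. The missing mass of the
  subprobability distribution (the value \<open>None\<close>) is the probability that the recursive
  protocol never terminates.
\<close>
partial_function (spmf) slots :: "nat \<Rightarrow> nat \<Rightarrow> nat spmf" where
  "slots K L =
    (if L = 0 then return_spmf 1
     else if L \<le> K then return_spmf L
     else bind_spmf (spmf_of_pmf (Pi_pmf {..<L} False (\<lambda>_. bernoulli_pmf (1/2)))) (\<lambda>g.
          bind_spmf (slots K (card {i \<in> {..<L}. g i})) (\<lambda>t1.
          bind_spmf (slots K (card {i \<in> {..<L}. \<not> g i})) (\<lambda>t2.
          return_spmf (1 + t1 + t2)))))"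

text \<open>
  The expectation is taken in the extended nonnegative reals, where it always exists;
  a run that never terminates uses infinitely many slots.
\<close>
definition expected_slots :: "nat \<Rightarrow> nat \<Rightarrow> ennreal" where
  "expected_slots K L =
    (\<integral>\<^sup>+ t. (case t of None \<Rightarrow> \<infinity> | Some n \<Rightarrow> of_nat n) \<partial>measure_pmf (slots K L))"

definition alpha_star :: "nat \<Rightarrow> real" where
  "alpha_star K = 1 + 1 / real K"

definition beta_star :: "nat \<Rightarrow> real" where
  "beta_star K = 1 + 2 / ((real K + 1) * (1 - 2 powi (- int K)))"

end

theory Submission
  imports Defs
begin

text \<open>
  For every slope \<open>\<gamma>\<close> the function \<open>d L = S L + 1 - \<gamma> * L\<close> satisfies the homogeneous recursion
  \<open>d L = 2 * (\<Sum>k\<le>L. (L choose k) * d k) / 2 ^ L\<close> for \<open>L > K\<close>, with \<open>d 0 = 2\<close> and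
  \<open>d k = 1 - (\<gamma> - 1) * k\<close> for \<open>1 \<le> k \<le> K\<close>. So the sign of \<open>d\<close> propagates by induction. For
  \<open>\<gamma> = alpha_star K\<close> all initial values are nonnegative; for \<open>\<gamma> = beta_star K\<close> the binomially weighted sum of the
  initial values is nonpositive for every \<open>L > K\<close>.
\<close>

subsection \<open>Binomial sums\<close>

text \<open>A fair split is symmetric under \<open>k\<close> to \<open>n - k\<close>, so both groups
  contribute the same sum. Restricting to finite values \<open>m\<close> moves the recursion from
  \<open>ennreal\<close> to real arithmetic.\<close>

lemma nn_integral_binomial_half:
  fixes m :: "nat \<Rightarrow> real"
  assumes "\<And>k. k \<le> n \<Longrightarrow> 0 \<le> m k"
  shows "(\<integral>\<^sup>+ k. 1 + ennreal (m k) + ennreal (m (n - k)) \<partial>binomial_pmf n (1/2)) =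
    ennreal (1 + 2 * (\<Sum>k\<le>n. real (n choose k) * m k) / 2 ^ n)"
proof -
  have pmf: "pmf (binomial_pmf n (1/2)) k = real (n choose k) / 2 ^ n" if "k \<le> n" for k
    using that by (simp add: power_divide flip: power_add)
  have "(\<integral>\<^sup>+ k. 1 + ennreal (m k) + ennreal (m (n - k)) \<partial>binomial_pmf n (1/2)) =
    (\<Sum>k\<le>n. (1 + ennreal (m k) + ennreal (m (n - k))) * ennreal (real (n choose k) / 2 ^ n))"
    by (subst nn_integral_measure_pmf_finite) (auto simp: pmf simp del: pmf_binomial intro!: sum.cong)
  also have "\<dots> = (\<Sum>k\<le>n. ennreal ((1 + m k + m (n - k)) * (real (n choose k) / 2 ^ n)))"
    using assms by (intro sum.cong refl)
      (simp add: ennreal_mult' ennreal_plus[symmetric] flip: ennreal_1 del: ennreal_plus times_divide_eq_right)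
  also have "\<dots> = ennreal (\<Sum>k\<le>n. (1 + m k + m (n - k)) * (real (n choose k) / 2 ^ n))"
    using assms by (intro sum_ennreal) simp
  also have "(\<Sum>k\<le>n. (1 + m k + m (n - k)) * (real (n choose k) / 2 ^ n)) =
    (\<Sum>k\<le>n. real (n choose k)) / 2 ^ n + (\<Sum>k\<le>n. real (n choose k) * m k) / 2 ^ n +
    (\<Sum>k\<le>n. real (n choose k) * m (n - k)) / 2 ^ n"
    by (simp add: sum_divide_distrib sum.distrib algebra_simps add_divide_distrib)
  also have "(\<Sum>k\<le>n. real (n choose k)) = 2 ^ n"
    using choose_row_sum[of n] by (simp flip: of_nat_sum)
  also have "(\<Sum>k\<le>n. real (n choose k) * m (n - k)) = (\<Sum>k\<le>n. real (n choose k) * m k)"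
    by (rule sum.reindex_bij_witness[where i="\<lambda>k. n - k" and j="\<lambda>k. n - k"])
       (auto simp: binomial_symmetric[symmetric])
  finally show ?thesis by (simp add: add.commute)
qed

text \<open>The mean of the fair binomial is \<open>n / 2\<close>, so doubling reproduces
  \<open>c * n\<close>, while the constant 1 becomes 2. The surplus absorbs the collision slot,
  which makes the recursion homogeneous.\<close>

lemma sum_choose_affine:
  "2 * (\<Sum>k\<le>n. real (n choose k) * (m k + 1 - c * real k)) / 2 ^ n =
   2 * (\<Sum>k\<le>n. real (n choose k) * m k) / 2 ^ n + 2 - c * real n"
proof -
  have s0: "(\<Sum>k\<le>n. real (n choose k)) = 2 ^ n"
    using choose_row_sum[of n] by (simp flip: of_nat_sum)
  have s1: "2 * (\<Sum>k\<le>n. real (n choose k) * real k) = real n * 2 ^ n"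
  proof (cases n)
    case (Suc l)
    have "(\<Sum>k\<le>n. real (n choose k) * real k) = real n * 2 ^ (n - 1)"
      using arg_cong[OF choose_linear_sum[of n], of real] by (simp add: mult.commute)
    then show ?thesis using Suc by simp
  qed simp
  have "2 * (\<Sum>k\<le>n. real (n choose k) * (m k + 1 - c * real k)) =
    2 * (\<Sum>k\<le>n. real (n choose k) * m k) + 2 * (\<Sum>k\<le>n. real (n choose k)) -
    c * (2 * (\<Sum>k\<le>n. real (n choose k) * real k))"
    by (simp add: algebra_simps sum.distrib sum_subtractf sum_distrib_left)
  then show ?thesis unfolding s0 s1 by (simp add: add_divide_distrib diff_divide_distrib)
qed

text \<open>
  The term for \<open>k = n\<close> on the right carries the weight \<open>2 / 2 ^ n < 1\<close>, so it can be
  absorbed on the left.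
\<close>
lemma binomial_mean_nonpos:
  fixes d :: "nat \<Rightarrow> real"
  assumes "n \<ge> 2" and "d n \<le> 2 * (\<Sum>k\<le>n. real (n choose k) * d k) / 2 ^ n"
    and "(\<Sum>k<n. real (n choose k) * d k) \<le> 0"
  shows "d n \<le> 0"
proof -
  have "(2::real) ^ 2 \<le> 2 ^ n" using assms(1) by (intro power_increasing) auto
  moreover have "d n * 2 ^ n \<le> 2 * (\<Sum>k<n. real (n choose k) * d k) + 2 * d n"
    using assms(2) by (simp add: field_simps flip: lessThan_Suc_atMost)
  ultimately have "d n * (2 ^ n - 2) \<le> 0" "(2::real) ^ n - 2 > 0"
    using assms(3) by (auto simp: algebra_simps)
  then show ?thesis by (simp add: mult_le_0_iff)
qed

text \<open>
  Passing from \<open>n\<close> to \<open>Suc n\<close> multiplies the \<open>k\<close>-th term by \<open>Suc n / (Suc n - k)\<close>, which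
  increases with \<open>k\<close>, while \<open>1 - c * k\<close> changes sign once, at \<open>1 / c\<close>. For \<open>n = Suc K\<close> the
  claim is an equality, which is where \<open>c\<close> comes from.
\<close>
lemma sum_choose_truncated_nonpos:
  fixes c :: real
  assumes "K \<ge> 1" "n > K" and c: "c = 2 / ((real K + 1) * (1 - 1 / 2 ^ K))"
  shows "1 + (\<Sum>k\<le>K. real (n choose k) * (1 - c * real k)) \<le> 0"
proof -
  have pos: "0 < 1 - 1 / (2::real) ^ K" "1 - 1 / (2::real) ^ K \<le> 1"
    using \<open>K \<ge> 1\<close> by auto
  then have "c > 0" by (simp add: c)
  \<comment> \<open>The sign change has to lie in the range up to \<open>K\<close>, where the growth
    factor \<open>w\<close> is shown below to be monotone.\<close>
  have "1 / c \<le> (real K + 1) * 1 / 2"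
    using pos(2) by (simp add: c)
  also have "\<dots> \<le> real K" using \<open>K \<ge> 1\<close> by simp
  finally have root: "1 / c \<le> real K" .
  have "Suc K \<le> n" using \<open>n > K\<close> by simp
  then show ?thesis
  proof (induction n rule: dec_induct)
    case base
    have s0: "(\<Sum>k\<le>K. real (Suc K choose k)) = 2 ^ Suc K - 1"
      using arg_cong[OF choose_row_sum[of "Suc K"], of real] by simp
    have "(\<Sum>k\<le>Suc K. k * (Suc K choose k)) = Suc K * 2 ^ K"
      using choose_linear_sum[of "Suc K"] by simp
    then have "real (\<Sum>k\<le>Suc K. k * (Suc K choose k)) = real (Suc K * 2 ^ K)"
      by (rule arg_cong)
    \<comment> \<open>Complete row sum minus its last term, \<open>k = Suc K\<close>, which equals
      \<open>Suc K\<close>.\<close>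
    then have s1: "(\<Sum>k\<le>K. real (Suc K choose k) * real k) = real (Suc K) * (2 ^ K - 1)"
      by (simp add: algebra_simps)
    have "(real K + 1) * (1 - 1 / 2 ^ K) * c = 2"
      using pos by (simp add: c)
    then have "(real K + 1) * (2 ^ K - 1) * c = 2 * 2 ^ K"
      by (simp add: field_simps)
    moreover have "(\<Sum>k\<le>K. real (Suc K choose k) * (1 - c * real k)) =
      (\<Sum>k\<le>K. real (Suc K choose k)) - c * (\<Sum>k\<le>K. real (Suc K choose k) * real k)"
      by (simp add: algebra_simps sum_subtractf sum_distrib_left)
    ultimately show ?case by (simp only: s0 s1) (simp add: algebra_simps)
  next
    case (step n)
    define w where "w x = (real n + 1) / (real n + 1 - x)" for x
    define g where "g k = real (n choose k) * (1 - c * real k)" for k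
    have w: "w x \<le> w y" if "x \<le> y" "y \<le> real K" for x y
      using that step.hyps unfolding w_def by (intro divide_left_mono mult_pos_pos) auto
    have ch: "real (Suc n choose k) = real (n choose k) * w (real k)" if "k \<le> K" for k
    proof -
      have "k \<le> n" using that step.hyps by simp
      have "(Suc n - k) * (Suc n choose k) = Suc n * (n choose k)"
        using binomial_absorb_comp[of "Suc n" k] by simp
      then have "real (Suc n - k) * real (Suc n choose k) = real (Suc n) * real (n choose k)"
        by (metis of_nat_mult)
      then show ?thesis using \<open>k \<le> n\<close> by (simp add: w_def of_nat_diff field_simps)
    qed
    \<comment> \<open>Freezing the factor at the sign change raises every term: nonnegative terms
      have smaller factors, nonpositive ones larger factors.\<close>
    have le: "g k * w (real k) \<le> g k * w (1 / c)" if "k \<le> K" for k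
    proof (cases "real k \<le> 1 / c")
      case True
      then have "0 \<le> 1 - c * real k" using \<open>c > 0\<close> by (simp add: field_simps)
      then have "0 \<le> g k" by (simp add: g_def)
      then show ?thesis using w[OF True root] by (intro mult_left_mono)
    next
      case False
      then have "1 - c * real k \<le> 0" using \<open>c > 0\<close> by (simp add: field_simps)
      then have "g k \<le> 0" by (simp add: g_def mult_nonneg_nonpos)
      then show ?thesis using w[of "1 / c" "real k"] False that by (intro mult_left_mono_neg) auto
    qed
    have w1: "1 \<le> w (1 / c)"
      using w[of 0 "1 / c"] root \<open>c > 0\<close> by (simp add: w_def)
    have "(\<Sum>k\<le>K. real (Suc n choose k) * (1 - c * real k)) = (\<Sum>k\<le>K. g k * w (real k))"
      by (intro sum.cong) (auto simp: ch g_def)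
    also have "\<dots> \<le> (\<Sum>k\<le>K. g k * w (1 / c))"
      by (intro sum_mono le) simp
    also have "\<dots> = (\<Sum>k\<le>K. g k) * w (1 / c)"
      by (simp add: sum_distrib_right)
    \<comment> \<open>The induction hypothesis bounds the old sum by -1, and a factor of at least 1
      preserves this bound.\<close>
    also have "\<dots> \<le> (- 1) * w (1 / c)"
      using step.IH w1 by (intro mult_right_mono) (auto simp: g_def)
    also have "\<dots> \<le> - 1" using w1 by simp
    finally show ?case by simp
  qed
qed

subsection \<open>The recursion for the expected number of slots\<close>

definition slot_cost :: "nat option \<Rightarrow> ennreal" where
  "slot_cost t = (case t of None \<Rightarrow> \<infinity> | Some n \<Rightarrow> of_nat n)"

text \<open>Nontermination of either run is absorbing. With this operation the recursion uses plain
  pmf binds, to which the integral rules apply directly.\<close>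

definition combine_slots :: "nat option \<Rightarrow> nat option \<Rightarrow> nat option" where
  "combine_slots s t = Option.bind s (\<lambda>a. Option.bind t (\<lambda>b. Some (1 + a + b)))"

lemma expected_slots_eq: "expected_slots K L = (\<integral>\<^sup>+ t. slot_cost t \<partial>slots K L)"
  by (simp add: expected_slots_def slot_cost_def)

lemma slot_cost_combine_slots: "slot_cost (combine_slots s t) = 1 + slot_cost s + slot_cost t"
  by (cases s; cases t) (auto simp: slot_cost_def combine_slots_def)

lemma slots_0: "slots K 0 = return_pmf (Some 1)"
  by (subst slots.simps) simp

lemma slots_le: "1 \<le> L \<Longrightarrow> L \<le> K \<Longrightarrow> slots K L = return_pmf (Some L)"
  by (subst slots.simps) simp

text \<open>Only the size of group 1 matters: it counts heads among \<open>L\<close> fair coins, and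
  group 2 is its complement.\<close>

lemma slots_gt:
  assumes "L > K"
  shows "slots K L = bind_pmf (binomial_pmf L (1/2)) (\<lambda>i.
    bind_pmf (slots K i) (\<lambda>s. bind_pmf (slots K (L - i)) (\<lambda>t. return_pmf (combine_slots s t))))"
proof -
  let ?G = "Pi_pmf {..<L} False (\<lambda>_. bernoulli_pmf (1/2))"
  have bin: "binomial_pmf L (1/2) = map_pmf (\<lambda>g. card {i \<in> {..<L}. g i}) ?G"
    by (rule binomial_pmf_altdef') auto
  have card: "card {i \<in> {..<L}. \<not> g i} = L - card {i \<in> {..<L}. g i}" for g
  proof -
    have "{i \<in> {..<L}. \<not> g i} = {..<L} - {i \<in> {..<L}. g i}" by auto
    then show ?thesis using card_Diff_subset[of "{i \<in> {..<L}. g i}" "{..<L}"] by auto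
  qed
  \<comment> \<open>The left side skips the second run after \<open>None\<close>; the right side
    samples it, but the result is \<open>None\<close> regardless.\<close>
  have bind: "bind_spmf p (\<lambda>a. bind_spmf q (\<lambda>b. return_spmf (1 + a + b))) =
    bind_pmf p (\<lambda>s. bind_pmf q (\<lambda>t. return_pmf (combine_slots s t)))" for p q
    unfolding bind_spmf_def
    by (intro bind_pmf_cong refl)
       (auto simp: combine_slots_def split: option.splits intro!: bind_pmf_cong)
  have "L \<noteq> 0" "\<not> L \<le> K" using assms by auto
  then show ?thesis
    by (subst slots.simps) (simp only: if_False card bind bind_spmf_of_pmf bin bind_map_pmf)
qed

lemma nn_integral_slots_gt:
  assumes "L > K"
  shows "(\<integral>\<^sup>+ t. F t \<partial>slots K L) = (\<integral>\<^sup>+ i. \<integral>\<^sup>+ s. \<integral>\<^sup>+ t. F (combine_slots s t)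
    \<partial>slots K (L - i) \<partial>slots K i \<partial>binomial_pmf L (1/2))"
  by (subst slots_gt[OF assms]) simp

lemma nn_integral_pmf_sum:
  "(\<integral>\<^sup>+ s. \<integral>\<^sup>+ t. 1 + f s + g t \<partial>measure_pmf q \<partial>measure_pmf p) =
   1 + (\<integral>\<^sup>+ s. f s \<partial>measure_pmf p) + (\<integral>\<^sup>+ t. g t \<partial>measure_pmf q)"
  by (simp add: nn_integral_add measure_pmf.emeasure_space_1)

lemma expected_slots_gt:
  assumes "L > K"
  shows "expected_slots K L =
    (\<integral>\<^sup>+ i. 1 + expected_slots K i + expected_slots K (L - i) \<partial>binomial_pmf L (1/2))"
  unfolding expected_slots_eq nn_integral_slots_gt[OF assms] slot_cost_combine_slots
    nn_integral_pmf_sum ..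

text \<open>
  The recursion alone does not bound the expectation, since it is also solved by \<open>\<infinity>\<close>.
  Capping the number of slots at a finite \<open>B\<close> makes all quantities finite and, by
  subadditivity of the minimum, turns the recursion into an inequality.
\<close>
definition capped_slots :: "nat \<Rightarrow> nat \<Rightarrow> nat \<Rightarrow> real" where
  "capped_slots K B L = enn2real (\<integral>\<^sup>+ t. min (of_nat B) (slot_cost t) \<partial>slots K L)"

lemma ennreal_capped_slots:
  "ennreal (capped_slots K B L) = (\<integral>\<^sup>+ t. min (of_nat B) (slot_cost t) \<partial>slots K L)"
proof -
  have "(\<integral>\<^sup>+ t. min (of_nat B) (slot_cost t) \<partial>slots K L) \<le> of_nat B"
    by (rule measure_pmf.nn_integral_le_const) auto
  also have "\<dots> < \<top>" by (rule of_nat_less_top)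
  finally show ?thesis by (simp add: capped_slots_def)
qed

lemma capped_slots_nonneg: "0 \<le> capped_slots K B L"
  by (simp add: capped_slots_def)

lemma SUP_min_of_nat: "(SUP n. min (of_nat n) x) = (x :: ennreal)"
  using SUP_inf[of "of_nat :: nat \<Rightarrow> ennreal" UNIV x]
  by (simp add: inf_min ennreal_SUP_of_nat_eq_top)

text \<open>Monotone convergence in the cap: a bound on \<open>capped_slots\<close> uniform in
  \<open>B\<close> also bounds the true expectation.\<close>

lemma expected_slots_eq_SUP: "expected_slots K L = (SUP B. ennreal (capped_slots K B L))"
proof -
  have "expected_slots K L = (\<integral>\<^sup>+ t. (SUP B. min (of_nat B) (slot_cost t)) \<partial>slots K L)"
    by (simp add: expected_slots_eq SUP_min_of_nat)
  also have "\<dots> = (SUP B. \<integral>\<^sup>+ t. min (of_nat B) (slot_cost t) \<partial>slots K L)"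
    by (rule nn_integral_monotone_convergence_SUP)
       (auto simp: incseq_def le_fun_def intro: min.coboundedI1)
  finally show ?thesis by (simp add: ennreal_capped_slots)
qed

lemma capped_slots_gt:
  assumes "L > K"
  shows "capped_slots K B L \<le> 1 + 2 * (\<Sum>k\<le>L. real (L choose k) * capped_slots K B k) / 2 ^ L"
proof -
  let ?f = "\<lambda>t. min (of_nat B) (slot_cost t)"
  have sub: "?f (combine_slots s t) \<le> 1 + ?f s + ?f t" for s t
  proof -
    \<comment> \<open>Once one run reaches the cap, its own capped cost is already \<open>B\<close>;
      otherwise neither summand is truncated.\<close>
    consider "slot_cost s \<le> of_nat B" "slot_cost t \<le> of_nat B"
      | "of_nat B \<le> slot_cost s" | "of_nat B \<le> slot_cost t"
      by fastforce
    then show ?thesis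
    proof cases
      case 1
      then show ?thesis by (simp add: slot_cost_combine_slots min_absorb2)
    next
      case 2
      then have "?f (combine_slots s t) \<le> ?f s" by (simp add: min_absorb1)
      also have "\<dots> \<le> 1 + ?f s + ?f t" by (intro add_increasing2 add_increasing) auto
      finally show ?thesis .
    next
      case 3
      then have "?f (combine_slots s t) \<le> ?f t" by (simp add: min_absorb1)
      also have "\<dots> \<le> 1 + ?f s + ?f t" by (intro add_increasing) auto
      finally show ?thesis .
    qed
  qed
  have "ennreal (capped_slots K B L) \<le>
    (\<integral>\<^sup>+ i. \<integral>\<^sup>+ s. \<integral>\<^sup>+ t. 1 + ?f s + ?f t
      \<partial>slots K (L - i) \<partial>slots K i \<partial>binomial_pmf L (1/2))"
    unfolding ennreal_capped_slots nn_integral_slots_gt[OF assms]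
    by (intro nn_integral_mono sub)
  also have "\<dots> = ennreal (1 + 2 * (\<Sum>k\<le>L. real (L choose k) * capped_slots K B k) / 2 ^ L)"
    unfolding nn_integral_pmf_sum ennreal_capped_slots[symmetric]
    by (rule nn_integral_binomial_half) (rule capped_slots_nonneg)
  finally show ?thesis
    by (subst (asm) ennreal_le_iff)
       (auto intro!: add_nonneg_nonneg divide_nonneg_nonneg sum_nonneg mult_nonneg_nonneg
          capped_slots_nonneg)
qed

lemma expected_slots_0: "expected_slots K 0 = 1"
  by (simp add: expected_slots_eq slots_0 slot_cost_def)

lemma expected_slots_le: "1 \<le> L \<Longrightarrow> L \<le> K \<Longrightarrow> expected_slots K L = of_nat L"
  by (simp add: expected_slots_eq slots_le slot_cost_def)

lemma capped_slots_le_if_expected_slots: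
  assumes "expected_slots K L = ennreal r" "r \<ge> 0"
  shows "capped_slots K B L \<le> r"
proof -
  have "ennreal (capped_slots K B L) \<le> expected_slots K L"
    unfolding expected_slots_eq_SUP by (rule SUP_upper) simp
  then show ?thesis using assms by simp
qed

subsection \<open>The bounds\<close>

lemma expected_slots_upper:
  fixes c :: real
  assumes "K \<ge> 1" "L > K" and c: "c = 2 / ((real K + 1) * (1 - 1 / 2 ^ K))"
  shows "expected_slots K L \<le> ennreal ((1 + c) * real L - 1)"
proof -
  have "capped_slots K B n + 1 - (1 + c) * real n \<le> 0" if "n > K" for B n
    using that
  proof (induction n rule: less_induct)
    case (less n)
    define d where "d k = capped_slots K B k + 1 - (1 + c) * real k" for k
    have d0: "d 0 \<le> 2"
      using capped_slots_le_if_expected_slots[of K 0 1 B] by (simp add: d_def expected_slots_0)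
    have d1: "d k \<le> 1 - c * real k" if "1 \<le> k" "k \<le> K" for k
      using capped_slots_le_if_expected_slots[of K k "real k" B] that
      by (simp add: d_def expected_slots_le ennreal_of_nat_eq_real_of_nat algebra_simps)
    have "(\<Sum>k<n. real (n choose k) * d k) =
      (\<Sum>k\<le>K. real (n choose k) * d k) + (\<Sum>k=Suc K..<n. real (n choose k) * d k)"
      using less.prems sum.atLeastLessThan_concat[of 0 "Suc K" n "\<lambda>k. real (n choose k) * d k"]
      by (simp add: atLeast0LessThan lessThan_Suc_atMost)
    also have "\<dots> \<le> (\<Sum>k\<le>K. real (n choose k) * d k)"
      using less by (auto simp: d_def intro!: sum_nonpos mult_nonneg_nonpos)
    \<comment> \<open>An empty group still costs one slot, so \<open>d 0\<close> may reach 2,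
      whereas \<open>1 - c * k\<close> gives 1 at \<open>k = 0\<close>. The extra 1 is the leading 1
      in \<open>sum_choose_truncated_nonpos\<close>.\<close>
    also have "\<dots> \<le> (\<Sum>k\<le>K. real (n choose k) * (1 - c * real k) + (if k = 0 then 1 else 0))"
    proof (rule sum_mono)
      fix k assume "k \<in> {..K}"
      then show "real (n choose k) * d k \<le>
        real (n choose k) * (1 - c * real k) + (if k = 0 then 1 else 0)"
        using d0 d1[of k] by (cases "k = 0") (auto intro!: mult_left_mono)
    qed
    also have "\<dots> \<le> 0"
      using sum_choose_truncated_nonpos[OF \<open>K \<ge> 1\<close> less.prems c] by (simp add: sum.distrib)
    finally have nonpos: "(\<Sum>k<n. real (n choose k) * d k) \<le> 0" .
    have "d n \<le> 2 * (\<Sum>k\<le>n. real (n choose k) * d k) / 2 ^ n"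
      unfolding d_def sum_choose_affine using capped_slots_gt[OF less.prems] by simp
    from binomial_mean_nonpos[OF _ this nonpos] show ?case
      using \<open>K \<ge> 1\<close> less.prems by (simp add: d_def)
  qed
  from this[OF \<open>L > K\<close>] have "capped_slots K B L \<le> (1 + c) * real L - 1" for B
    by (simp add: algebra_simps)
  then show ?thesis
    unfolding expected_slots_eq_SUP by (intro SUP_least ennreal_leI)
qed

text \<open>Finiteness, obtained from the upper bound, lets the lower bound use the exact recursion
  over the reals without a cap.\<close>

lemma expected_slots_finite:
  assumes "K \<ge> 1"
  shows "expected_slots K L < \<top>"
proof (cases "L > K")
  case True
  show ?thesis using expected_slots_upper[OF assms True refl] by (rule order_le_less_trans) simp
next
  case False
  then show ?thesis
    by (cases "L = 0") (auto simp: expected_slots_0 expected_slots_le of_nat_less_top)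
qed

lemma expected_slots_lower:
  assumes "K \<ge> 1" "L > K"
  shows "ennreal ((1 + 1 / real K) * real L - 1) \<le> expected_slots K L"
proof -
  define m where "m n = enn2real (expected_slots K n)" for n
  have m: "expected_slots K n = ennreal (m n)" "0 \<le> m n" for n
    using expected_slots_finite[OF \<open>K \<ge> 1\<close>] by (auto simp: m_def)
  have rec: "m n = 1 + 2 * (\<Sum>k\<le>n. real (n choose k) * m k) / 2 ^ n" if "n > K" for n
  proof -
    have "ennreal (m n) = ennreal (1 + 2 * (\<Sum>k\<le>n. real (n choose k) * m k) / 2 ^ n)"
      using expected_slots_gt[OF that] m(2) by (simp add: m(1) nn_integral_binomial_half)
    then show ?thesis
      by (subst (asm) ennreal_inj)
         (auto intro!: add_nonneg_nonneg divide_nonneg_nonneg sum_nonneg mult_nonneg_nonneg m)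
  qed
  have "m n + 1 - (1 + 1 / real K) * real n \<ge> 0" for n
  proof (induction n rule: less_induct)
    case (less n)
    define d where "d k = m k + 1 - (1 + 1 / real K) * real k" for k
    consider "n = 0" | "1 \<le> n" "n \<le> K" | "n > K" by linarith
    then show ?case
    proof cases
      case 1
      then show ?thesis using m(2)[of 0] by simp
    next
      case 2
      then have "m n = real n" by (simp add: m_def expected_slots_le)
      \<comment> \<open>The claim reduces to \<open>1 - n / K \<ge> 0\<close>, with equality at
        \<open>n = K\<close>; this fixes the slope.\<close>
      then show ?thesis using 2 by (simp add: field_simps)
    next
      case 3
      have "d n = 2 * (\<Sum>k\<le>n. real (n choose k) * d k) / 2 ^ n"
        unfolding d_def sum_choose_affine by (simp add: rec[OF 3])
      moreover have "(\<Sum>k<n. real (n choose k) * d k) \<ge> 0"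
        using less by (auto simp: d_def intro!: sum_nonneg)
      ultimately have "- d n \<le> 0"
        using 3 \<open>K \<ge> 1\<close>
        by (intro binomial_mean_nonpos[of n "\<lambda>k. - d k"]) (auto simp: sum_negf)
      then show ?thesis by (simp add: d_def)
    qed
  qed
  from this[of L] have "(1 + 1 / real K) * real L - 1 \<le> m L" by simp
  then show ?thesis unfolding m(1) by (rule ennreal_leI)
qed

theorem theorem4:
  fixes K :: nat
  assumes "K \<ge> 1"
  shows "(\<forall>L::nat. 1 \<le> L \<and> L \<le> K \<longrightarrow> expected_slots K L = of_nat L) \<and>
         (\<forall>L::nat. L > K \<longrightarrow>
            ennreal (alpha_star K * real L - 1) \<le> expected_slots K L \<and>
            expected_slots K L \<le> ennreal (beta_star K * real L - 1))"
proof -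
  have "beta_star K = 1 + 2 / ((real K + 1) * (1 - 1 / 2 ^ K))"
    by (simp add: beta_star_def power_int_minus field_simps)
  then show ?thesis
    unfolding alpha_star_def
    using expected_slots_le expected_slots_lower[OF assms] expected_slots_upper[OF assms _ refl]
    by metis
qed

end
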